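(* For every integer $N\ge1$, $$E_N^{2\text{-adic}}\ge\frac N2-1\qquad\text{and}\qquad E_N^{\mathrm{rat}}\ge 2^{\frac N2-1}+\frac{N-5}4 .$$
   Context: For an integer $N\ge 1$ and a finite binary sequence $\mathcal S^N=(s_0,\dots,s_{N-1})\in\{0,1\}^N$, the $N$th rational complexity is $$\Lambda_{\mathcal S^N}(N)=\min\left\{\max\{|f|,q\}: f,q\in\mathbb Z,\ q>0\text{ odd},\ q\sum_{i=0}^{N-1}s_i2^i\equiv f \bmod 2^N\right\},$$ and the $N$th $2$-adic complexity is $\lambda_{\mathcal S^N}(N)=\log_2\Lambda_{\mathcal S^N}(N)$. The expected values are $$E_N^{\mathrm{rat}}=\frac1{2^N}\sum_{\mathcal S^N\in\{0,1\}^N}\Lambda_{\mathcal S^N}(N),\qquad E_N^{2\text{-adic}}=\frac1{2^N}\sum_{\mathcal S^N\in\{0,1\}^N}\lambda_{\mathcal S^N}(N).$$ *)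

theory Defs
  imports Complex_Main "HOL-Library.FuncSet" "HOL-Number_Theory.Cong"
begin

text \<open>Finite binary sequences of length \<open>N\<close>, indexed by \<open>0, \<dots>, N - 1\<close>; extensionality makes
  each of the \<open>2 ^ N\<close> sequences be represented exactly once.\<close>

definition binary_seqs :: "nat \<Rightarrow> (nat \<Rightarrow> int) set" where
  "binary_seqs N = {..<N} \<rightarrow>\<^sub>E {0, 1}"

definition rational_complexity :: "(nat \<Rightarrow> int) \<Rightarrow> nat \<Rightarrow> nat" where
  "rational_complexity s N =
     (LEAST m::nat. \<exists>f q::int. q > 0 \<and> odd q \<and> [q * (\<Sum>i<N. s i * 2 ^ i) = f] (mod 2 ^ N)
        \<and> int m = max \<bar>f\<bar> q)"

definition two_adic_complexity :: "(nat \<Rightarrow> int) \<Rightarrow> nat \<Rightarrow> real" where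
  "two_adic_complexity s N = log 2 (real (rational_complexity s N))"

definition expected_rational_complexity :: "nat \<Rightarrow> real" where
  "expected_rational_complexity N =
     1 / 2 ^ N * (\<Sum>s\<in>binary_seqs N. real (rational_complexity s N))"

definition expected_two_adic_complexity :: "nat \<Rightarrow> real" where
  "expected_two_adic_complexity N =
     1 / 2 ^ N * (\<Sum>s\<in>binary_seqs N. two_adic_complexity s N)"

lemma card_binary_seqs: "card (binary_seqs N) = 2 ^ N"
  by (simp add: binary_seqs_def card_PiE numeral_2_eq_2)

text \<open>The minimum is over a nonempty set, so it is attained.\<close>

lemma rational_complexity_attained:
  "\<exists>f q::int. q > 0 \<and> odd q \<and> [q * (\<Sum>i<N. s i * 2 ^ i) = f] (mod 2 ^ N)
      \<and> int (rational_complexity s N) = max \<bar>f\<bar> q"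
  unfolding rational_complexity_def
proof (rule LeastI)
  let ?f = "\<Sum>i<N. s i * 2 ^ i"
  show "\<exists>f q::int. q > 0 \<and> odd q \<and> [q * ?f = f] (mod 2 ^ N)
      \<and> int (nat (max \<bar>?f\<bar> 1)) = max \<bar>f\<bar> q"
    by (intro exI[of _ ?f] exI[of _ 1]) simp
qed

end

theory Submission
  imports Defs
begin

text \<open>
  Fix \<open>N\<close> and identify a sequence with the residue \<open>S\<close> modulo \<open>2 ^ N\<close> that it expands. Complexity
  at most \<open>m\<close> means that \<open>S\<close> is the residue of a fraction \<open>f / q\<close> of height at most \<open>m\<close> with odd
  positive denominator, and there are only about \<open>m\<^sup>2\<close> such fractions: \<open>(m + 1) div 2\<close> denominators
  against \<open>2 * m + 1\<close> numerators. The \<open>2 * m + 1\<close> is too generous, since \<open>0 / q\<close>, \<open>q / q\<close>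
  and \<open>- q / q\<close> are the same three residues for every \<open>q\<close>. Counting these three once leaves
  \<open>2 * m - 2\<close> numerators for each denominator, and the factors \<open>m + 1\<close> and \<open>m - 1\<close> combine to the
  clean bound of at most \<open>m\<^sup>2 + 2\<close> sequences (lemma \<open>card_rational_complexity_le\<close>).

  So most of the \<open>2 ^ N\<close> sequences have complexity at least of the order of \<open>2 powr (N / 2)\<close>. The mean
  of an increasing function \<open>\<phi>\<close> of the complexity is bounded by summation by parts: cut \<open>\<phi>\<close> off at
  a level \<open>M\<close>; each step from \<open>\<phi> m\<close> to \<open>\<phi> (m + 1)\<close> with \<open>m < M\<close> is missed by at most \<open>m\<^sup>2 + 2\<close>
  sequences (lemma \<open>mean_rational_complexity_ge\<close>). Both expected values are instances.

  For \<open>\<phi> = log 2\<close>, the loss \<open>(m\<^sup>2 + 2) * log 2 (1 + 1 / m)\<close> of one step is at most \<open>2 * m + 1\<close>, so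
  the losses telescope and the mean is at least \<open>log 2 M - (M\<^sup>2 - 1) / 2 ^ N\<close>. As a function of
  \<open>u = M\<^sup>2 / 2 ^ N\<close>, the main part \<open>log 2 M - u\<close> equals \<open>N / 2 + (log 2 u) / 2 - u\<close>, which is
  exactly \<open>N / 2 - 1\<close> both at \<open>u = 1\<close> and at \<open>u = 1 / 2\<close>. The level \<open>M = 2 ^ (N div 2)\<close> realises
  the first value when \<open>N\<close> is even and the second when \<open>N\<close> is odd.

  For \<open>\<phi> m = m\<close> the same level gives a lower bound of about \<open>2 / 3 * 2 powr (N / 2)\<close> for even \<open>N\<close> and
  \<open>5 / (6 * sqrt 2) * 2 powr (N / 2)\<close> for odd \<open>N\<close>. Both constants exceed \<open>1 / 2\<close>, and the excess
  absorbs the linear term \<open>(N - 5) / 4\<close>.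
\<close>

section \<open>Counting the sequences of small rational complexity\<close>

lemma binary_expansion_unique:
  fixes s t :: "nat \<Rightarrow> int"
  assumes "[(\<Sum>i<N. s i * 2 ^ i) = (\<Sum>i<N. t i * 2 ^ i)] (mod 2 ^ N)"
    and "\<And>i. i < N \<Longrightarrow> s i \<in> {0, 1}" and "\<And>i. i < N \<Longrightarrow> t i \<in> {0, 1}"
    and "i < N"
  shows "s i = t i"
  using assms
proof (induction N arbitrary: i)
  case 0
  then show ?case by simp
next
  case (Suc N)
  let ?S = "\<lambda>u::nat \<Rightarrow> int. \<Sum>i<N. u i * 2 ^ i"
  have top: "[?S s + s N * 2 ^ N = ?S t + t N * 2 ^ N] (mod 2 ^ Suc N)"
    using Suc.prems(1) by simp
  then have "[?S s + s N * 2 ^ N = ?S t + t N * 2 ^ N] (mod 2 ^ N)"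
    by (rule cong_dvd_modulus) simp
  then have "[?S s = ?S t] (mod 2 ^ N)"
    by (simp add: cong_def)
  then have lower: "s j = t j" if "j < N" for j
    using Suc.IH[of j] Suc.prems(2,3) that by simp
  then have "?S s = ?S t" by simp
  with top have "(2::int) ^ Suc N dvd (s N - t N) * 2 ^ N"
    by (simp add: cong_iff_dvd_diff left_diff_distrib)
  then have "even (s N - t N)" by simp
  then have "s N = t N"
    using Suc.prems(2)[of N] Suc.prems(3)[of N] by auto
  with lower Suc.prems(4) show ?case
    by (cases "i = N") auto
qed

text \<open>
  Pairs of a denominator and a numerator, in this order. The residues \<open>0\<close>, \<open>1\<close> and \<open>- 1\<close> are
  listed once with denominator \<open>1\<close>, instead of once for every denominator.
\<close>

definition low_fractions :: "nat \<Rightarrow> (int \<times> int) set" where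
  "low_fractions m = {(1, 0), (1, 1), (1, -1)} \<union>
     (SIGMA q : {q. odd q \<and> 1 \<le> q \<and> q \<le> int m}. {- int m..int m} - {0, q, - q})"

lemma card_odd_upto: "card {q::int. odd q \<and> 1 \<le> q \<and> q \<le> int m} = Suc m div 2"
proof -
  have "{q::int. odd q \<and> 1 \<le> q \<and> q \<le> int m} = (\<lambda>i. 2 * int i + 1) ` {..<Suc m div 2}"
  proof (intro set_eqI iffI)
    fix q :: int
    assume "q \<in> {q. odd q \<and> 1 \<le> q \<and> q \<le> int m}"
    then obtain j where "q = 2 * j + 1" "1 \<le> q" "q \<le> int m"
      by (auto elim: oddE)
    then have "q = 2 * int (nat j) + 1" "nat j < Suc m div 2"
      by linarith+
    then show "q \<in> (\<lambda>i. 2 * int i + 1) ` {..<Suc m div 2}"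
      by blast
  qed auto
  then show ?thesis
    by (simp add: card_image inj_on_def)
qed

lemma low_fractions_card:
  assumes "1 \<le> m"
  shows "finite (low_fractions m)" and "card (low_fractions m) \<le> m\<^sup>2 + 2"
proof -
  let ?Q = "{q::int. odd q \<and> 1 \<le> q \<and> q \<le> int m}"
  let ?S = "SIGMA q : ?Q. {- int m..int m} - {0, q, - q}"
  have finQ: "finite ?Q"
    by (rule finite_subset[of _ "{1..int m}"]) auto
  then show "finite (low_fractions m)"
    by (simp add: low_fractions_def)
  \<comment> \<open>Since \<open>1 \<le> q \<le> m\<close>, the three removed numerators are distinct and lie in the interval.\<close>
  have "card ({- int m..int m} - {0, q, - q}) = 2 * m - 2" if "q \<in> ?Q" for q
    using that by (subst card_Diff_subset) auto
  then have "card ?S = (Suc m div 2) * (2 * m - 2)"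
    using finQ by (simp add: card_odd_upto)
  also have "\<dots> = (2 * (Suc m div 2)) * (m - 1)"
    by (simp add: algebra_simps)
  also have "\<dots> \<le> (m + 1) * (m - 1)"
    by (intro mult_right_mono) auto
  also have "\<dots> = m\<^sup>2 - 1"
    by (simp add: power2_eq_square algebra_simps)
  finally have "card ?S \<le> m\<^sup>2 - 1" .
  moreover have "card (low_fractions m) \<le> card {(1::int, 0::int), (1, 1), (1, -1)} + card ?S"
    unfolding low_fractions_def by (rule card_Un_le)
  moreover have "1 \<le> m\<^sup>2"
    using assms by simp
  ultimately show "card (low_fractions m) \<le> m\<^sup>2 + 2"
    by simp
qed

text \<open>
  An odd \<open>q\<close> is invertible modulo \<open>2 ^ N\<close>, so an optimal pair whose fraction is \<open>0\<close>, \<open>1\<close> or \<open>- 1\<close>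
  may be reduced to denominator \<open>1\<close>; every other optimal pair is listed already.
\<close>

lemma low_fraction_exists:
  assumes "rational_complexity s N \<le> m"
  shows "\<exists>p \<in> low_fractions m. odd (fst p) \<and> [fst p * (\<Sum>i<N. s i * 2 ^ i) = snd p] (mod 2 ^ N)"
proof -
  let ?S = "\<Sum>i<N. s i * 2 ^ i"
  obtain f q :: int where fq: "q > 0" "odd q" "[q * ?S = f] (mod 2 ^ N)"
    and "int (rational_complexity s N) = max \<bar>f\<bar> q"
    using rational_complexity_attained by blast
  with assms have bounds: "\<bar>f\<bar> \<le> int m" "q \<le> int m"
    by linarith+
  have "coprime q (2 ^ N)"
    using fq(2) by simp
  then have cancel: "[?S = c] (mod 2 ^ N)" if "f = q * c" for c
    using fq(3) that by (simp add: cong_mult_lcancel)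
  consider "f = q * 0" | "f = q * 1" | "f = q * (- 1)" | "f \<noteq> 0" "f \<noteq> q" "f \<noteq> - q"
    by fastforce
  then show ?thesis
  proof cases
    case 1
    with cancel[OF 1] show ?thesis
      by (intro bexI[of _ "(1, 0)"]) (auto simp: low_fractions_def)
  next
    case 2
    with cancel[OF 2] show ?thesis
      by (intro bexI[of _ "(1, 1)"]) (auto simp: low_fractions_def)
  next
    case 3
    with cancel[OF 3] show ?thesis
      by (intro bexI[of _ "(1, - 1)"]) (auto simp: low_fractions_def)
  next
    case 4
    with fq bounds show ?thesis
      by (intro bexI[of _ "(q, f)"]) (auto simp: low_fractions_def)
  qed
qed

text \<open>
  A fraction with odd denominator determines its residue modulo \<open>2 ^ N\<close>, hence the sequence. Any
  choice of a representing fraction is therefore injective.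
\<close>

lemma card_rational_complexity_le:
  assumes "1 \<le> m"
  shows "card {s \<in> binary_seqs N. rational_complexity s N \<le> m} \<le> m\<^sup>2 + 2"
proof -
  let ?A = "{s \<in> binary_seqs N. rational_complexity s N \<le> m}"
  let ?S = "\<lambda>s::nat \<Rightarrow> int. \<Sum>i<N. s i * 2 ^ i"
  have "\<exists>g. \<forall>s \<in> ?A. g s \<in> low_fractions m \<and> odd (fst (g s)) \<and>
      [fst (g s) * ?S s = snd (g s)] (mod 2 ^ N)"
    using low_fraction_exists by (intro bchoice) blast
  then obtain g where g: "\<And>s. s \<in> ?A \<Longrightarrow> g s \<in> low_fractions m"
      "\<And>s. s \<in> ?A \<Longrightarrow> odd (fst (g s))"
      "\<And>s. s \<in> ?A \<Longrightarrow> [fst (g s) * ?S s = snd (g s)] (mod 2 ^ N)"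
    by blast
  have "inj_on g ?A"
  proof (rule inj_onI)
    fix s t
    assume st: "s \<in> ?A" "t \<in> ?A" and eq: "g s = g t"
    have "[fst (g s) * ?S s = fst (g s) * ?S t] (mod 2 ^ N)"
      using cong_trans[OF g(3)[OF st(1)] cong_sym[OF g(3)[OF st(2), folded eq]]] .
    moreover have "coprime (fst (g s)) (2 ^ N)"
      using g(2)[OF st(1)] by simp
    ultimately have "[?S s = ?S t] (mod 2 ^ N)"
      by (simp add: cong_mult_lcancel)
    moreover have "s i \<in> {0, 1}" "t i \<in> {0, 1}" if "i < N" for i
      using st that by (auto simp: binary_seqs_def PiE_iff)
    ultimately have "s i = t i" if "i < N" for i
      using binary_expansion_unique that by blast
    then show "s = t"
      using st by (intro PiE_ext[of s "{..<N}" "\<lambda>_. {0, 1}" t]) (auto simp: binary_seqs_def)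
  qed
  then have "card ?A \<le> card (low_fractions m)"
    using g(1) low_fractions_card(1)[OF assms] by (intro card_inj_on_le) auto
  with low_fractions_card(2)[OF assms] show ?thesis
    by simp
qed

section \<open>Truncated summation by parts\<close>

lemma rational_complexity_pos: "1 \<le> rational_complexity s N"
  using rational_complexity_attained[of s N] by (auto simp: max_def split: if_splits)

lemma finite_binary_seqs: "finite (binary_seqs N)"
  by (simp add: binary_seqs_def finite_PiE)

text \<open>
  For \<open>l \<le> M\<close> the left-hand side telescopes to \<open>\<phi> l\<close>; for \<open>l > M\<close> it is the cut-off value \<open>\<phi> M\<close>.
  In this form, \<open>l\<close> enters only through the indicators of \<open>l \<le> m\<close>, which turn into the counting
  function when one sums over all sequences.
\<close>

lemma truncated_summation_by_parts:
  fixes \<phi> :: "nat \<Rightarrow> real"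
  assumes "1 \<le> l" and "1 \<le> M" and mono: "\<And>m n. 1 \<le> m \<Longrightarrow> m \<le> n \<Longrightarrow> \<phi> m \<le> \<phi> n"
  shows "\<phi> M - (\<Sum>m\<in>{1..<M}. of_bool (l \<le> m) * (\<phi> (Suc m) - \<phi> m)) \<le> \<phi> l"
proof (cases "l \<le> M")
  case True
  have "(\<Sum>m\<in>{1..<M}. of_bool (l \<le> m) * (\<phi> (Suc m) - \<phi> m)) =
      (\<Sum>m\<in>{l..<M}. \<phi> (Suc m) - \<phi> m)"
    using assms(1) by (intro sum.mono_neutral_cong_right) auto
  also have "\<dots> = \<phi> M - \<phi> l"
    using True by (rule sum_Suc_diff')
  finally show ?thesis
    by simp
next
  case False
  then have "(\<Sum>m\<in>{1..<M}. of_bool (l \<le> m) * (\<phi> (Suc m) - \<phi> m)) = 0"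
    by (intro sum.neutral) auto
  with mono[OF assms(2)] False show ?thesis
    by simp
qed

text \<open>
  Exchanging the sum over sequences with the sum over levels replaces each indicator by the number
  of sequences of complexity at most \<open>m\<close>, which is bounded by \<open>m\<^sup>2 + 2\<close>.
\<close>

lemma mean_rational_complexity_ge:
  fixes \<phi> :: "nat \<Rightarrow> real"
  assumes "1 \<le> M" and mono: "\<And>m n. 1 \<le> m \<Longrightarrow> m \<le> n \<Longrightarrow> \<phi> m \<le> \<phi> n"
  shows "\<phi> M - (\<Sum>m\<in>{1..<M}. (real m ^ 2 + 2) * (\<phi> (Suc m) - \<phi> m)) / 2 ^ N
    \<le> 1 / 2 ^ N * (\<Sum>s\<in>binary_seqs N. \<phi> (rational_complexity s N))"
proof -
  let ?B = "binary_seqs N"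
  let ?L = "\<lambda>s. rational_complexity s N"
  have "2 ^ N * \<phi> M - (\<Sum>m\<in>{1..<M}. (real m ^ 2 + 2) * (\<phi> (Suc m) - \<phi> m))
      \<le> 2 ^ N * \<phi> M - (\<Sum>m\<in>{1..<M}. real (card {s \<in> ?B. ?L s \<le> m}) * (\<phi> (Suc m) - \<phi> m))"
  proof (intro diff_left_mono sum_mono mult_right_mono)
    fix m assume "m \<in> {1..<M}"
    then have m: "1 \<le> m" by simp
    show "real (card {s \<in> ?B. ?L s \<le> m}) \<le> real m ^ 2 + 2"
      using of_nat_mono[OF card_rational_complexity_le[OF m, of N], where 'a = real] by simp
    show "0 \<le> \<phi> (Suc m) - \<phi> m"
      using mono[OF m, of "Suc m"] by simp
  qed
  also have "\<dots> = 2 ^ N * \<phi> M -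
      (\<Sum>m\<in>{1..<M}. \<Sum>s\<in>?B. of_bool (?L s \<le> m) * (\<phi> (Suc m) - \<phi> m))"
    by (simp add: sum_distrib_right[symmetric] finite_binary_seqs Int_def)
  also have "\<dots> = 2 ^ N * \<phi> M -
      (\<Sum>s\<in>?B. \<Sum>m\<in>{1..<M}. of_bool (?L s \<le> m) * (\<phi> (Suc m) - \<phi> m))"
    by (subst sum.swap) simp
  also have "\<dots> = (\<Sum>s\<in>?B. \<phi> M - (\<Sum>m\<in>{1..<M}. of_bool (?L s \<le> m) * (\<phi> (Suc m) - \<phi> m)))"
    by (simp add: sum_subtractf card_binary_seqs)
  also have "\<dots> \<le> (\<Sum>s\<in>?B. \<phi> (?L s))"
    by (intro sum_mono truncated_summation_by_parts[OF rational_complexity_pos assms])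
  finally have "(2 ^ N * \<phi> M - (\<Sum>m\<in>{1..<M}. (real m ^ 2 + 2) * (\<phi> (Suc m) - \<phi> m))) / 2 ^ N
      \<le> (\<Sum>s\<in>?B. \<phi> (?L s)) / 2 ^ N"
    by (rule divide_right_mono) simp
  then show ?thesis
    by (simp add: diff_divide_distrib)
qed

section \<open>The two expected values\<close>

text \<open>
  The right-hand side is \<open>(m + 1)\<^sup>2 - m\<^sup>2\<close>, so that the bounds telescope. Equality holds at \<open>m = 1\<close>,
  which is why that case stands apart from the estimate \<open>ln (1 + 1 / m) \<le> 1 / m\<close>.
\<close>

lemma log2_increment_le:
  assumes "1 \<le> m"
  shows "(real m ^ 2 + 2) * (log 2 (real (Suc m)) - log 2 (real m)) \<le> 2 * real m + 1"
proof (cases "m = 1")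
  case True
  then show ?thesis by simp
next
  case False
  with assms have m: "2 \<le> m" by simp
  \<comment> \<open>The remaining cases need \<open>ln 2 \<ge> 3 / 5\<close>, with no room to spare at \<open>m = 2\<close>; it follows
    from \<open>exp 1 \<le> 3\<close>, because \<open>3 ^ 3 = 27 \<le> 32 = 2 ^ 5\<close>.\<close>
  have "exp (3 / 5 :: real) ^ 5 \<le> 2 ^ 5"
  proof -
    have "exp (3 / 5 :: real) ^ 5 = exp 1 ^ 3"
      by (simp flip: exp_of_nat_mult)
    also have "\<dots> \<le> 3 ^ 3"
      by (intro power_mono exp_le) simp
    finally show ?thesis by simp
  qed
  then have "exp (3 / 5 :: real) \<le> 2"
    by (subst (asm) power_mono_iff) auto
  then have ln2: "3 / 5 \<le> ln (2::real)"
    by (subst ln_ge_iff) auto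
  have "1 + 1 / real m = real (Suc m) / real m"
    using m by (simp add: field_simps)
  then have "ln (1 + 1 / real m) = ln (real (Suc m)) - ln (real m)"
    using m by (simp only: ln_div) simp
  then have "(real m ^ 2 + 2) * (ln (real (Suc m)) - ln (real m)) =
      (real m ^ 2 + 2) * ln (1 + 1 / real m)"
    by simp
  also have "\<dots> \<le> (real m ^ 2 + 2) * (1 / real m)"
    by (intro mult_left_mono ln_add_one_self_le_self) auto
  also have "\<dots> = real m + 2 / real m"
    using m by (simp add: field_simps power2_eq_square)
  also have "\<dots> \<le> real m + 1"
    using m by (simp add: field_simps)
  also have "\<dots> \<le> (2 * real m + 1) * (3 / 5)"
    using m by simp
  also have "\<dots> \<le> (2 * real m + 1) * ln 2"
    using ln2 by (intro mult_left_mono) auto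
  finally show ?thesis
    by (simp add: log_def field_simps)
qed

lemma expected_two_adic_complexity_ge:
  assumes "1 \<le> M"
  shows "log 2 (real M) - (real M ^ 2 - 1) / 2 ^ N \<le> expected_two_adic_complexity N"
proof -
  have "(\<Sum>m\<in>{1..<M}. (real m ^ 2 + 2) * (log 2 (real (Suc m)) - log 2 (real m)))
      \<le> (\<Sum>m\<in>{1..<M}. real (Suc m) ^ 2 - real m ^ 2)"
    using log2_increment_le by (intro sum_mono) (simp add: power2_eq_square algebra_simps)
  also have "\<dots> = real M ^ 2 - 1"
    using sum_Suc_diff'[OF assms, of "\<lambda>m. real m ^ 2"] by simp
  finally have "(\<Sum>m\<in>{1..<M}. (real m ^ 2 + 2) * (log 2 (real (Suc m)) - log 2 (real m))) / 2 ^ N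
      \<le> (real M ^ 2 - 1) / 2 ^ N"
    by (simp add: divide_right_mono)
  moreover have "log 2 (real M) -
      (\<Sum>m\<in>{1..<M}. (real m ^ 2 + 2) * (log 2 (real (Suc m)) - log 2 (real m))) / 2 ^ N
      \<le> expected_two_adic_complexity N"
    unfolding expected_two_adic_complexity_def two_adic_complexity_def
    by (rule mean_rational_complexity_ge[OF assms]) simp
  ultimately show ?thesis
    by linarith
qed

lemma expected_rational_complexity_ge:
  assumes "1 \<le> M"
  shows "real M - (real M - 1) * (2 * real M ^ 2 - real M + 12) / (6 * 2 ^ N)
    \<le> expected_rational_complexity N"
proof -
  have closed_form:
    "(\<Sum>m\<in>{1..<M}. real m ^ 2 + 2) = (real M - 1) * (2 * real M ^ 2 - real M + 12) / 6"
    using assms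
  proof (induction M rule: dec_induct)
    case (step n)
    then show ?case
      by (simp add: field_simps power2_eq_square)
  qed simp
  have "real M - (\<Sum>m\<in>{1..<M}. real m ^ 2 + 2) / 2 ^ N \<le> expected_rational_complexity N"
    using mean_rational_complexity_ge[OF assms, of real N]
    by (simp add: expected_rational_complexity_def)
  then show ?thesis
    by (simp only: closed_form divide_divide_eq_left)
qed

text \<open>
  This trades the exponent \<open>k\<close> for \<open>x = 2 ^ k\<close>, after which the estimates for the
  rational complexity are polynomial inequalities in \<open>x\<close> alone;
  a slope of \<open>4\<close> is steep enough for the small excess over \<open>x / sqrt 2\<close> available for odd \<open>N\<close>.
\<close>

lemma linear_le_power2: "4 * real k - 5 \<le> 2 ^ k"
proof (induction k)
  case (Suc k)
  show ?case
  proof (cases "2 \<le> k")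
    case True
    then have "(2::real) ^ 2 \<le> 2 ^ k"
      by (intro power_increasing) auto
    with Suc show ?thesis by simp
  next
    case False
    then have "k = 0 \<or> k = 1" by linarith
    then show ?thesis by auto
  qed
qed simp

theorem theorem2:
  fixes N :: nat
  assumes "N \<ge> 1"
  shows "expected_two_adic_complexity N \<ge> real N / 2 - 1 \<and>
         expected_rational_complexity N \<ge> 2 powr (real N / 2 - 1) + (real N - 5) / 4"
proof -
  define k where "k = N div 2"
  define x :: real where "x = 2 ^ k"
  have M: "1 \<le> (2::nat) ^ k" "real (2 ^ k) = x" "log 2 x = real k" "1 \<le> x"
    by (simp_all add: x_def log_nat_power)
  have adic: "real k - (x ^ 2 - 1) / 2 ^ N \<le> expected_two_adic_complexity N"
    using expected_two_adic_complexity_ge[OF M(1), of N] M by simp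
  have rat: "x - (x - 1) * (2 * x ^ 2 - x + 12) / (6 * 2 ^ N) \<le> expected_rational_complexity N"
    using expected_rational_complexity_ge[OF M(1), of N] M by simp
  have lin: "4 * real k - 5 \<le> x"
    unfolding x_def by (rule linear_le_power2)
  show ?thesis
  proof (cases "even N")
    case True
    then have N: "N = 2 * k"
      by (simp add: k_def)
    then have pow: "(2::real) ^ N = x ^ 2"
      by (simp add: x_def power_mult mult.commute)
    have "1 \<le> k"
      using assms N by simp
    then have x: "2 \<le> x"
      unfolding x_def using power_increasing[of 1 k "2::real"] by simp
    have powr: "(2::real) powr (real N / 2 - 1) = x / 2"
      using N by (simp add: powr_diff powr_realpow x_def)
    have polynomial: "x / 2 + (2 * real k - 5) / 4 \<le> x - (x - 1) * (2 * x ^ 2 - x + 12) / (6 * x ^ 2)"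
    proof -
      \<comment> \<open>The claim below, multiplied by \<open>24 * x\<^sup>2\<close>; \<open>x - 5\<close> bounds \<open>4 * k - 10\<close>.\<close>
      have "0 \<le> x * x ^ 2 + 27 * (x * (x - 2)) + 2 * x + 48"
        using x by (intro add_nonneg_nonneg mult_nonneg_nonneg) auto
      then have "x / 2 + (x - 5) / 8 \<le> x - (x - 1) * (2 * x ^ 2 - x + 12) / (6 * x ^ 2)"
        using x by (simp add: field_simps power2_eq_square)
      moreover have "(2 * real k - 5) / 4 \<le> (x - 5) / 8"
        using lin by simp
      ultimately show ?thesis
        by (meson add_left_mono order_trans)
    qed
    have "real N / 2 - 1 = real k - 1"
      using N by simp
    also have "\<dots> \<le> real k - (x ^ 2 - 1) / x ^ 2"
      using x by (simp add: field_simps)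
    also have "\<dots> \<le> expected_two_adic_complexity N"
      using adic by (simp only: pow)
    finally have two_adic: "real N / 2 - 1 \<le> expected_two_adic_complexity N" .
    have "2 powr (real N / 2 - 1) + (real N - 5) / 4 = x / 2 + (2 * real k - 5) / 4"
      using N powr by simp
    also note polynomial
    also have "x - (x - 1) * (2 * x ^ 2 - x + 12) / (6 * x ^ 2) \<le> expected_rational_complexity N"
      using rat by (simp only: pow)
    finally show ?thesis
      using two_adic by blast
  next
    case False
    then have N: "N = 2 * k + 1"
      by (simp add: k_def)
    then have pow: "(2::real) ^ N = 2 * x ^ 2"
      by (simp add: x_def power_mult mult.commute)
    have "(2::real) powr (real N / 2 - 1) = 2 powr (real k - 1 / 2)"
      using N by (simp add: field_simps)
    also have "\<dots> = x * sqrt (1 / 2)"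
      by (simp add: powr_diff powr_realpow powr_half_sqrt x_def real_sqrt_divide)
    also have "\<dots> \<le> x * (17 / 24)"
      using M by (intro mult_left_mono real_le_lsqrt) (auto simp: power2_eq_square)
    finally have powr: "(2::real) powr (real N / 2 - 1) \<le> x * (17 / 24)" .
    have polynomial: "x * (17 / 24) + (2 * real k - 4) / 4
        \<le> x - (x - 1) * (2 * x ^ 2 - x + 12) / (12 * x ^ 2)"
    proof -
      \<comment> \<open>The claim below, multiplied by \<open>24 * x\<^sup>2\<close>; the cubic terms cancel, which is
        what the constant \<open>17 / 24 = 5 / 6 - 1 / 8\<close> was chosen for. It exceeds \<open>sqrt (1 / 2)\<close>.\<close>
      have "0 \<le> 2 * x ^ 2 + 13 * (x - 1) ^ 2 + 11"
        using M by (intro add_nonneg_nonneg) auto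
      then have "x * (17 / 24) + (x - 3) / 8 \<le> x - (x - 1) * (2 * x ^ 2 - x + 12) / (12 * x ^ 2)"
        using M by (simp add: field_simps power2_eq_square)
      moreover have "(2 * real k - 4) / 4 \<le> (x - 3) / 8"
        using lin by simp
      ultimately show ?thesis
        by (meson add_left_mono order_trans)
    qed
    have "real N / 2 - 1 = real k - 1 / 2"
      using N by (simp add: field_simps)
    also have "\<dots> \<le> real k - (x ^ 2 - 1) / (2 * x ^ 2)"
      using M by (simp add: field_simps)
    also have "\<dots> \<le> expected_two_adic_complexity N"
      using adic by (simp only: pow)
    finally have two_adic: "real N / 2 - 1 \<le> expected_two_adic_complexity N" .
    have "(real N - 5) / 4 = (2 * real k - 4) / 4"
      using N by simp
    with powr have "2 powr (real N / 2 - 1) + (real N - 5) / 4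
        \<le> x * (17 / 24) + (2 * real k - 4) / 4"
      by (intro add_mono) simp_all
    also note polynomial
    also have "x - (x - 1) * (2 * x ^ 2 - x + 12) / (12 * x ^ 2) =
        x - (x - 1) * (2 * x ^ 2 - x + 12) / (6 * (2 * x ^ 2))"
      by simp
    also have "\<dots> \<le> expected_rational_complexity N"
      using rat by (simp only: pow)
    finally show ?thesis
      using two_adic by blast
  qed
qed

end
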